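(* Let $t_0\ge 0$, let $J\subseteq[t_0,\infty)$ be an interval with left endpoint $t_0\in J$, and let $p:J\to D^n\subset\mathbb{R}^{2n}$ be a trajectory of the $n$ robot positions such that the inverse $\left(I-\frac{\partial c}{\partial p}(p(t),t)\right)^{-1}$ is well-defined for all $t\in J$. Suppose that $p(t_0)=c(p(t_0),t_0)$ and that $$\dot p(t)=\left(I-\frac{\partial c}{\partial p}(p(t),t)\right)^{-1}\frac{\partial c}{\partial t}(p(t),t)\qquad\text{for all } t\in J .$$ Then $$\left\|p(t)-c(p(t),t)\right\|=0\qquad\text{for all } t\in J .$$
   Context: $D\subset\mathbb{R}^2$ is a two-dimensional convex domain, and $\phi:D\times[0,\infty)\to(0,\infty)$ is a density function that is bounded and continuously differentiable in both arguments. There are $n$ robots with positions $p_i\in D$, $i=1,\dots,n$, stacked as $p=[p_1^T,\dots,p_n^T]^T\in\mathbb{R}^{2n}$; the positions are pairwise distinct. The Voronoi cell of robot $i$ is $$V_i(p)=\{q\in D : \|q-p_i\|\le\|q-p_j\| \text{ for all } j\ne i\}.$$ Its mass and center of mass at time $t$ are $$m_i(p,t)=\int_{V_i(p)}\phi(q,t)\,dq,\qquad c_i(p,t)=\frac{1}{m_i(p,t)}\int_{V_i(p)}q\,\phi(q,t)\,dq,$$ and $c=[c_1^T,\dots,c_n^T]^T\in\mathbb{R}^{2n}$. Here $\frac{\partial c}{\partial p}$ is the $2n\times 2n$ Jacobian matrix of $c(p,t)$ with respect to $p$ and $\frac{\partial c}{\partial t}\in\mathbb{R}^{2n}$ is the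 partial derivative of $c(p,t)$ with respect to $t$ with $p$ held fixed. The integrals above are understood to be finite and $c$ is understood to be differentiable as a function of $(p,t)$ at the points $(p(t),t)$ considered, and $I$ is the $2n\times 2n$ identity matrix. A configuration satisfying $p=c(p,t)$ is called a centroidal Voronoi tessellation at time $t$. *)

theory Defs
  imports "HOL-Analysis.Analysis"
begin

text \<open>
  A stacked configuration of the robots lives in \<open>real ^ ('n \<times> 2)\<close>, i.e. in 2n-dimensional
  Euclidean space with n the cardinality of \<open>'n\<close>; coordinate \<open>(i, k)\<close> is the k-th component
  of the position of robot i.
\<close>

definition pos :: "real ^ ('n::finite \<times> 2) \<Rightarrow> 'n \<Rightarrow> real ^ 2" where
  "pos p i = (\<chi> k. p $ (i, k))"

definition configs :: "(real ^ 2) set \<Rightarrow> (real ^ ('n::finite \<times> 2)) set" where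
  "configs D = {p. (\<forall>i. pos p i \<in> D) \<and> (\<forall>i j. i \<noteq> j \<longrightarrow> pos p i \<noteq> pos p j)}"

definition voronoi :: "(real ^ 2) set \<Rightarrow> real ^ ('n::finite \<times> 2) \<Rightarrow> 'n \<Rightarrow> (real ^ 2) set" where
  "voronoi D p i = {q \<in> D. \<forall>j. j \<noteq> i \<longrightarrow> norm (q - pos p i) \<le> norm (q - pos p j)}"

text \<open>
  The measure is \<open>lebesgue\<close> rather than \<open>lborel\<close> because a convex set is always Lebesgue
  measurable but need not be Borel.
\<close>

definition mass ::
  "(real ^ 2) set \<Rightarrow> (real ^ 2 \<Rightarrow> real \<Rightarrow> real) \<Rightarrow> real ^ ('n::finite \<times> 2) \<Rightarrow> real \<Rightarrow> 'n \<Rightarrow> real" where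
  "mass D \<phi> p t i = set_lebesgue_integral lebesgue (voronoi D p i) (\<lambda>q. \<phi> q t)"

definition center ::
  "(real ^ 2) set \<Rightarrow> (real ^ 2 \<Rightarrow> real \<Rightarrow> real) \<Rightarrow> real ^ ('n::finite \<times> 2) \<Rightarrow> real \<Rightarrow> 'n \<Rightarrow> real ^ 2" where
  "center D \<phi> p t i =
     (1 / mass D \<phi> p t i) *\<^sub>R set_lebesgue_integral lebesgue (voronoi D p i) (\<lambda>q. \<phi> q t *\<^sub>R q)"

definition centers ::
  "(real ^ 2) set \<Rightarrow> (real ^ 2 \<Rightarrow> real \<Rightarrow> real) \<Rightarrow> real ^ ('n::finite \<times> 2) \<Rightarrow> real \<Rightarrow> real ^ ('n \<times> 2)" where
  "centers D \<phi> p t = (\<chi> ik. center D \<phi> p t (fst ik) $ snd ik)"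

text \<open>
  The function c is defined on configurations in D and nonnegative times only, so its partial
  derivatives are taken within these sets. This is the ordinary Jacobian at interior
  configurations and the one-sided time derivative at time 0.
\<close>

definition dc_dp ::
  "(real ^ 2) set \<Rightarrow> (real ^ 2 \<Rightarrow> real \<Rightarrow> real) \<Rightarrow> real ^ ('n::finite \<times> 2) \<Rightarrow> real
     \<Rightarrow> real ^ ('n \<times> 2) ^ ('n \<times> 2)" where
  "dc_dp D \<phi> p t = jacobian (\<lambda>x. centers D \<phi> x t) (at p within configs D)"

definition dc_dt ::
  "(real ^ 2) set \<Rightarrow> (real ^ 2 \<Rightarrow> real \<Rightarrow> real) \<Rightarrow> real ^ ('n::finite \<times> 2) \<Rightarrow> real
     \<Rightarrow> real ^ ('n \<times> 2)" where
  "dc_dt D \<phi> p t = vector_derivative (\<lambda>s. centers D \<phi> p s) (at t within {0..})"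

text \<open>
  Joint continuous differentiability on \<open>D \<times> [0, \<infinity>)\<close>, one-sided at boundary points.
\<close>

definition C1_density :: "(real ^ 2) set \<Rightarrow> (real ^ 2 \<Rightarrow> real \<Rightarrow> real) \<Rightarrow> bool" where
  "C1_density D \<phi> \<longleftrightarrow>
     (\<exists>\<phi>' :: (real ^ 2) \<times> real \<Rightarrow> ((real ^ 2) \<times> real) \<Rightarrow>\<^sub>L real.
        (\<forall>z \<in> D \<times> {0..}.
           ((\<lambda>(q, t). \<phi> q t) has_derivative blinfun_apply (\<phi>' z)) (at z within D \<times> {0..})) \<and>
        continuous_on (D \<times> {0..}) \<phi>')"

end

theory Submission imports Defs begin

text \<open>
  The error \<open>p - c(p, t)\<close> is constant along the trajectory: by the chain rule its derivative is
  \<open>(I - \<partial>c/\<partial>p) p' - \<partial>c/\<partial>t\<close>, which the differential equation makes vanish. The delicate point is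
  that \<open>\<partial>c/\<partial>p\<close> is a choice among derivatives within the set of configurations; it is unique,
  even at the boundary, because a convex set with nonempty interior has an open set of
  inward directions at each of its points.
\<close>

text \<open>Along each ray with direction in \<open>U\<close>, both maps give the one-sided
  derivative of the same function of one real variable, so they agree on \<open>U\<close>. A linear
  map is determined by its values on a nonempty open set.\<close>

lemma has_derivative_within_unique_on_open_directions:
  fixes f :: "'a::real_normed_vector \<Rightarrow> 'b::real_normed_vector"
  assumes A: "(f has_derivative A) (at x within S)"
    and B: "(f has_derivative B) (at x within S)"
    and "open U" and "U \<noteq> {}"
    and dir: "\<And>v. v \<in> U \<Longrightarrow> \<forall>\<^sub>F h in at_right (0::real). x + h *\<^sub>R v \<in> S"
  shows "A = B"
proof
  interpret A: bounded_linear A using A by (rule has_derivative_bounded_linear)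
  interpret B: bounded_linear B using B by (rule has_derivative_bounded_linear)
  have eqU: "A v = B v" if v: "v \<in> U" for v
  proof -
    obtain b where b: "b > 0" and S: "\<And>h. 0 < h \<Longrightarrow> h < b \<Longrightarrow> x + h *\<^sub>R v \<in> S"
      using dir[OF v] by (auto simp: eventually_at_right_field)
    have line: "((\<lambda>h. x + h *\<^sub>R v) has_derivative (\<lambda>h. h *\<^sub>R v)) (at 0 within {0<..<b})"
      by (auto intro!: derivative_eq_intros)
    \<comment> \<open>The ray is restricted to the open interval \<open>{0<..<b}\<close>: its points
      lie in \<open>S\<close> there, and 0 is still a limit point, which is what uniqueness
      requires.\<close>
    have vd: "((\<lambda>h. f (x + h *\<^sub>R v)) has_vector_derivative L v) (at 0 within {0<..<b})"
      if L: "(f has_derivative L) (at x within S)" for L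
    proof -
      have "(f has_derivative L) (at (x + 0 *\<^sub>R v) within (\<lambda>h. x + h *\<^sub>R v) ` {0<..<b})"
        using S by (auto intro!: has_derivative_subset[OF L])
      from diff_chain_within[OF line this] linear_scale[OF has_derivative_linear[OF L]]
      show ?thesis by (simp add: has_vector_derivative_def o_def)
    qed
    have "(0::real) islimpt {0<..<b}"
      using b by (simp add: islimpt_greaterThanLessThan1)
    then have "at (0::real) within {0<..<b} \<noteq> bot"
      by (simp add: trivial_limit_within)
    then show ?thesis
      using vd[OF A] vd[OF B] by (rule vector_derivative_unique_within)
  qed
  fix w
  \<comment> \<open>An arbitrary \<open>w\<close> is reached as a difference of directions in
    \<open>U\<close>: for small \<open>e\<close> both \<open>v\<close> and
    \<open>v + e *\<^sub>R w\<close> lie in \<open>U\<close>, and linearity isolates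
    \<open>e *\<^sub>R A w\<close>.\<close>
  obtain v where v: "v \<in> U" using \<open>U \<noteq> {}\<close> by blast
  have "((\<lambda>e. v + e *\<^sub>R w) \<longlongrightarrow> v + 0 *\<^sub>R w) (at_right (0::real))"
    by (intro tendsto_intros)
  then have "\<forall>\<^sub>F e in at_right (0::real). v + e *\<^sub>R w \<in> U"
    using \<open>open U\<close> v by (auto dest: topological_tendstoD)
  then obtain e :: real where e: "e > 0" "v + e *\<^sub>R w \<in> U"
    unfolding eventually_at_right_field using dense[of 0] by blast
  from eqU[OF v] eqU[OF e(2)] have "e *\<^sub>R A w = e *\<^sub>R B w"
    by (simp add: A.add B.add A.scaleR B.scaleR)
  with e(1) show "A w = B w" by simp
qed

lemma pos_add_scaleR: "pos (x + h *\<^sub>R v) i = pos x i + h *\<^sub>R pos v i"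
  by (simp add: pos_def vec_eq_iff)

lemma continuous_on_pos [continuous_intros]:
  "continuous_on S g \<Longrightarrow> continuous_on S (\<lambda>x. pos (g x) i)"
  unfolding pos_def by (intro continuous_intros)

text \<open>Supplies the open set of directions for the uniqueness lemma. Aiming every robot at an
  interior point of \<open>D\<close> keeps it in \<open>D\<close> by convexity, and distinct robots
  stay distinct for small \<open>h\<close> by continuity.\<close>

lemma configs_inward_directions:
  fixes x :: "real ^ ('n::finite \<times> 2)"
  assumes "convex D" and "interior D \<noteq> {}" and x: "x \<in> configs D"
  obtains U where "open U" and "U \<noteq> {}"
    and "\<And>v. v \<in> U \<Longrightarrow> \<forall>\<^sub>F h in at_right (0::real). x + h *\<^sub>R v \<in> configs D"
proof
  let ?U = "{v. \<forall>i. pos (x + v) i \<in> interior D}"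
  have "?U = (\<Inter>i. (\<lambda>v. pos (x + v) i) -` interior D)" by auto
  also have "open \<dots>"
    by (intro open_INT ballI open_vimage continuous_intros) auto
  finally show "open ?U" .
  \<comment> \<open>The witness sends all robots to the same point \<open>z\<close>. Their collision
    at \<open>h = 1\<close> is harmless, since \<open>U\<close> constrains only membership in the
    interior and the claim concerns small \<open>h\<close>.\<close>
  obtain z where "z \<in> interior D" using assms(2) by blast
  then have "(\<chi> ik. z $ snd ik) - x \<in> ?U"
    by (simp add: pos_def vec_nth_inverse)
  then show "?U \<noteq> {}" by blast
  fix v assume v: "v \<in> ?U"
  have D: "pos (x + h *\<^sub>R v) i \<in> D" if "0 < h" "h < 1" for h i
  proof -
    have "(1 - h) *\<^sub>R pos x i + h *\<^sub>R pos (x + v) i \<in> D"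
      using that x v \<open>convex D\<close> interior_subset[of D]
      by (intro convexD_alt) (auto simp: configs_def)
    moreover have "pos (x + v) i = pos x i + pos v i"
      using pos_add_scaleR[of x 1 v i] by simp
    ultimately show ?thesis by (simp add: pos_add_scaleR algebra_simps)
  qed
  have distinct: "\<forall>\<^sub>F h in at_right (0::real). \<forall>i j. i \<noteq> j \<longrightarrow> pos (x + h *\<^sub>R v) i \<noteq> pos (x + h *\<^sub>R v) j"
  proof (intro eventually_all_finite)
    fix i j
    have lim: "((\<lambda>h. pos (x + h *\<^sub>R v) i - pos (x + h *\<^sub>R v) j) \<longlongrightarrow>
        (pos x i + 0 *\<^sub>R pos v i) - (pos x j + 0 *\<^sub>R pos v j)) (at_right (0::real))"
      unfolding pos_add_scaleR by (intro tendsto_intros)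
    show "\<forall>\<^sub>F h in at_right (0::real). i \<noteq> j \<longrightarrow> pos (x + h *\<^sub>R v) i \<noteq> pos (x + h *\<^sub>R v) j"
    proof (cases "i = j")
      case False
      then have "(pos x i + 0 *\<^sub>R pos v i) - (pos x j + 0 *\<^sub>R pos v j) \<noteq> 0"
        using x by (simp add: configs_def)
      from tendsto_imp_eventually_ne[OF lim this] show ?thesis
        by eventually_elim simp
    qed simp
  qed
  have "\<forall>\<^sub>F h in at_right (0::real). 0 < h \<and> h < 1"
    unfolding eventually_at_right_field by (auto intro: exI[of _ 1])
  with distinct show "\<forall>\<^sub>F h in at_right (0::real). x + h *\<^sub>R v \<in> configs D"
    by eventually_elim (use D in \<open>auto simp: configs_def\<close>)
qed

text \<open>\<open>jacobian\<close> is the matrix of \<open>frechet_derivative\<close>, which is a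
  choice among derivatives within \<open>configs D\<close>. Uniqueness identifies it with the
  spatial part of any joint derivative \<open>L\<close>.\<close>

lemma dc_dp_eq:
  fixes x :: "real ^ ('n::finite \<times> 2)"
  assumes "convex D" and "interior D \<noteq> {}" and "x \<in> configs D" and "t \<ge> 0"
    and L: "((\<lambda>(x, s). centers D \<phi> x s) has_derivative L) (at (x, t) within configs D \<times> {0..})"
  shows "dc_dp D \<phi> x t *v w = L (w, 0)"
proof -
  have "((\<lambda>y. (y, t)) has_derivative (\<lambda>w. (w, 0))) (at x within configs D)"
    by (auto intro!: derivative_eq_intros)
  moreover have "((\<lambda>(x, s). centers D \<phi> x s) has_derivative L)
      (at (x, t) within (\<lambda>y. (y, t)) ` configs D)"
    using \<open>t \<ge> 0\<close> by (auto intro!: has_derivative_subset[OF L])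
  ultimately have part: "((\<lambda>y. centers D \<phi> y t) has_derivative (\<lambda>w. L (w, 0))) (at x within configs D)"
    by (auto dest: diff_chain_within simp: o_def)
  then have fd: "((\<lambda>y. centers D \<phi> y t) has_derivative
      frechet_derivative (\<lambda>y. centers D \<phi> y t) (at x within configs D)) (at x within configs D)"
    using differentiableI frechet_derivative_works by blast
  obtain U where "open U" "U \<noteq> {}"
    "\<And>v. v \<in> U \<Longrightarrow> \<forall>\<^sub>F h in at_right (0::real). x + h *\<^sub>R v \<in> configs D"
    using configs_inward_directions[OF assms(1-3)] by blast
  from has_derivative_within_unique_on_open_directions[OF fd part this]
  show ?thesis
    using matrix_works[of "frechet_derivative (\<lambda>y. centers D \<phi> y t) (at x within configs D)"]
      has_derivative_linear[OF fd] by (simp add: dc_dp_def jacobian_def linear_matrix_vector_mul_eq)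
qed

text \<open>The time counterpart: \<open>vector_derivative\<close> is also a choice, unique because
  every \<open>t \<ge> 0\<close> is a limit point of \<open>{0..}\<close>.\<close>

lemma dc_dt_eq:
  fixes x :: "real ^ ('n::finite \<times> 2)"
  assumes "x \<in> configs D" and "t \<ge> 0"
    and L: "((\<lambda>(x, s). centers D \<phi> x s) has_derivative L) (at (x, t) within configs D \<times> {0..})"
  shows "dc_dt D \<phi> x t = L (0, 1)"
proof -
  have "((\<lambda>s. (x, s)) has_derivative (\<lambda>h. (0, h))) (at t within {0..})"
    by (auto intro!: derivative_eq_intros)
  moreover have "((\<lambda>(x, s). centers D \<phi> x s) has_derivative L)
      (at (x, t) within (\<lambda>s. (x, s)) ` {0..})"
    using \<open>x \<in> configs D\<close> by (auto intro!: has_derivative_subset[OF L])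
  ultimately have "((\<lambda>s. centers D \<phi> x s) has_derivative (\<lambda>h. L (0, h))) (at t within {0..})"
    by (auto dest: diff_chain_within simp: o_def)
  moreover have "(\<lambda>h. L (0, h)) = (\<lambda>h. h *\<^sub>R L (0, 1))"
  proof
    fix h :: real
    show "L (0, h) = h *\<^sub>R L (0, 1)"
      using linear_scale[OF has_derivative_linear[OF L], of h "(0, 1)"] by simp
  qed
  ultimately have vd: "((\<lambda>s. centers D \<phi> x s) has_vector_derivative L (0, 1)) (at t within {0..})"
    by (simp only: has_vector_derivative_def)
  \<comment> \<open>Approaching from the right covers the boundary time \<open>t = 0\<close> as
    well.\<close>
  have "t islimpt {t<..<t + 1}" by (simp add: islimpt_greaterThanLessThan1)
  then have "t islimpt {0..}"
    by (rule islimpt_subset) (use \<open>t \<ge> 0\<close> in auto)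
  then have "at t within {0..} \<noteq> bot" by (simp add: trivial_limit_within)
  from vector_derivative_within[OF this vd] show ?thesis by (simp add: dc_dt_def)
qed

theorem mainTheorem1:
  fixes D :: "(real ^ 2) set"
    and \<phi> :: "real ^ 2 \<Rightarrow> real \<Rightarrow> real"
    and p :: "real \<Rightarrow> real ^ ('n::finite \<times> 2)"
    and t0 :: real
    and J :: "real set"
  assumes "convex D" and "interior D \<noteq> {}"
    and "\<forall>q\<in>D. \<forall>t\<ge>0. \<phi> q t > 0"
    and "bounded {\<phi> q t | q t. q \<in> D \<and> t \<ge> 0}"
    and "C1_density D \<phi>"
    and "\<forall>x \<in> (configs D :: (real ^ ('n \<times> 2)) set). \<forall>t\<ge>0. \<forall>i.
           set_integrable lebesgue (voronoi D x i) (\<lambda>q. \<phi> q t) \<and>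
           set_integrable lebesgue (voronoi D x i) (\<lambda>q. \<phi> q t *\<^sub>R q)"
    and "t0 \<ge> 0" and "is_interval J" and "t0 \<in> J" and "J \<subseteq> {t0..}"
    and "\<forall>t\<in>J. p t \<in> configs D"
    and "\<forall>t\<in>J. (\<lambda>(x, s). centers D \<phi> x s) differentiable (at (p t, t) within configs D \<times> {0..})"
    and "\<forall>t\<in>J. invertible (mat 1 - dc_dp D \<phi> (p t) t)"
    and "p t0 = centers D \<phi> (p t0) t0"
    and "\<forall>t\<in>J. (p has_vector_derivative
                   (matrix_inv (mat 1 - dc_dp D \<phi> (p t) t) *v dc_dt D \<phi> (p t) t)) (at t within J)"
  shows "\<forall>t\<in>J. norm (p t - centers D \<phi> (p t) t) = 0"
proof -
  let ?c = "\<lambda>(x, s). centers D \<phi> x s"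
  have zero: "((\<lambda>t. p t - centers D \<phi> (p t) t) has_derivative (\<lambda>h. 0)) (at t within J)"
    if t: "t \<in> J" for t
  proof -
    have t_nonneg: "t \<ge> 0" and config: "p t \<in> configs D" using assms(7,10,11) t by auto
    obtain L where L: "(?c has_derivative L) (at (p t, t) within configs D \<times> {0..})"
      using assms(12) t by (auto simp: differentiable_def)
    define A where "A = mat 1 - dc_dp D \<phi> (p t) t"
    define v where "v = matrix_inv A *v dc_dt D \<phi> (p t) t"
    have p: "(p has_derivative (\<lambda>h. h *\<^sub>R v)) (at t within J)"
      using assms(15) t by (simp add: has_vector_derivative_def A_def v_def)
    have "invertible A" using assms(13) t by (simp add: A_def)
    \<comment> \<open>\<open>matrix_inv\<close> is defined by choice, so its inverse property has to
      be extracted from invertibility.\<close>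
    then have "A ** matrix_inv A = mat 1" 
      unfolding invertible_def matrix_inv_def by (metis (mono_tags, lifting) someI_ex)
    then have "A *v v = dc_dt D \<phi> (p t) t"
      by (simp add: v_def matrix_vector_mul_assoc)
    \<comment> \<open>The differential equation in terms of \<open>L\<close>: \<open>A *v v\<close>
      is \<open>v - L (v, 0)\<close>, and the time derivative is \<open>L (0, 1)\<close>.\<close>
    then have "v = L (v, 0) + L (0, 1)"
      using dc_dp_eq[OF assms(1,2) config t_nonneg L, of v] dc_dt_eq[OF config t_nonneg L]
      by (simp add: A_def matrix_vector_mult_diff_rdistrib algebra_simps)
    \<comment> \<open>Since \<open>(v, 1)\<close> is the velocity of the curve
      \<open>(p s, s)\<close>, this says that the centers move with the same velocity
      \<open>v\<close> as the robots.\<close>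
    then have Lv: "L (v, 1) = v"
      using linear_add[OF has_derivative_linear[OF L], of "(v, 0)" "(0, 1)"] by simp
    have "((\<lambda>s. (p s, s)) has_derivative (\<lambda>h. (h *\<^sub>R v, h))) (at t within J)"
      using p by (auto intro!: derivative_eq_intros)
    moreover have "(?c has_derivative L) (at (p t, t) within (\<lambda>s. (p s, s)) ` J)"
      using assms(7,10,11) by (fastforce intro!: has_derivative_subset[OF L])
    ultimately have "((\<lambda>s. centers D \<phi> (p s) s) has_derivative (\<lambda>h. L (h *\<^sub>R v, h))) (at t within J)"
      by (auto dest: diff_chain_within simp: o_def)
    moreover have "L (h *\<^sub>R v, h) = h *\<^sub>R v" for h
      using linear_scale[OF has_derivative_linear[OF L], of h "(v, 1)"] Lv by simp
    ultimately have "((\<lambda>s. centers D \<phi> (p s) s) has_derivative (\<lambda>h. h *\<^sub>R v)) (at t within J)"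
      by simp
    from has_derivative_diff[OF p this] show ?thesis by simp
  qed
  \<comment> \<open>A zero derivative within a convex set forces a constant error \<open>k\<close>;
    the initial condition at \<open>t0\<close> makes it 0.\<close>
  have "convex J" using assms(8) by (rule is_interval_convex)
  then obtain k where k: "\<And>t. t \<in> J \<Longrightarrow> p t - centers D \<phi> (p t) t = k"
    using has_derivative_zero_constant[of J, OF _ zero] by auto
  with assms(9,14) have "k = 0" by force
  with k show ?thesis by simp
qed

end
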